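(* For every graph $G$ of order $n$ and every $k=1,\dots,n-1$, $$\mu_k(G)+\mu_{n-k+1}(\overline{G})\ge -1-2\sqrt{2s(G)}.$$
   Context: For a graph $G$ of order $n$, $\mu_1(G)\ge\dots\ge\mu_n(G)$ are the eigenvalues of its adjacency matrix; $\overline{G}$ is the complement of $G$. With $m$ the number of edges and $d(u)$ the degree of $u$, $s(G)=\sum_{u\in V(G)}|d(u)-2m/n|$. *)

theory Defs
  imports Complex_Main "Jordan_Normal_Form.Char_Poly"
begin

definition simple_graph :: "'a set \<Rightarrow> 'a set set \<Rightarrow> bool" where
  "simple_graph V E \<longleftrightarrow> finite V \<and> E \<subseteq> {e. e \<subseteq> V \<and> card e = 2}"

definition complement_edges :: "'a set \<Rightarrow> 'a set set \<Rightarrow> 'a set set" where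
  "complement_edges V E = {e. e \<subseteq> V \<and> card e = 2} - E"

definition degree_of :: "'a set set \<Rightarrow> 'a \<Rightarrow> nat" where
  "degree_of E u = card {e \<in> E. u \<in> e}"

definition degree_deviation :: "'a set \<Rightarrow> 'a set set \<Rightarrow> real" where
  "degree_deviation V E =
     (\<Sum>u\<in>V. \<bar>real (degree_of E u) - 2 * real (card E) / real (card V)\<bar>)"

text \<open>Matrices are indexed by natural numbers, so the rows and columns of the adjacency matrix
  follow a list of the vertices. No loop entries arise, since \<open>{v, v}\<close> is not a two-element set.\<close>

definition adjacency_mat :: "'a list \<Rightarrow> 'a set set \<Rightarrow> real mat" where
  "adjacency_mat vs E =
     mat (length vs) (length vs) (\<lambda>(i, j). if {vs ! i, vs ! j} \<in> E then 1 else 0)"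

text \<open>The real roots of the characteristic polynomial with multiplicity, largest first. A symmetric
  matrix has as many of them as rows (\<open>length_eigenvalue_list\<close> below).\<close>

definition eigenvalue_list :: "real mat \<Rightarrow> real list" where
  "eigenvalue_list A = rev (sorted_list_of_multiset (proots (char_poly A)))"

definition vertex_list :: "'a set \<Rightarrow> 'a list" where
  "vertex_list V = (SOME vs. distinct vs \<and> set vs = V)"

text \<open>The index \<open>k\<close> counts from 1. The chosen vertex list does not affect the value
  (\<open>graph_eigenvalue_eq\<close> below).\<close>

definition graph_eigenvalue :: "'a set \<Rightarrow> 'a set set \<Rightarrow> nat \<Rightarrow> real" where
  "graph_eigenvalue V E k = eigenvalue_list (adjacency_mat (vertex_list V) E) ! (k - 1)"

lemma vertex_list:
  assumes "finite V"
  shows "distinct (vertex_list V)" "set (vertex_list V) = V" "length (vertex_list V) = card V"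
proof -
  have "\<exists>vs. distinct vs \<and> set vs = V"
    using finite_distinct_list[OF assms] by blast
  then have *: "distinct (vertex_list V) \<and> set (vertex_list V) = V"
    unfolding vertex_list_def by (rule someI_ex)
  then show "distinct (vertex_list V)" "set (vertex_list V) = V" by auto
  then show "length (vertex_list V) = card V" using distinct_card by fastforce
qed

lemma adjacency_mat_carrier: "adjacency_mat vs E \<in> carrier_mat (length vs) (length vs)"
  by (simp add: adjacency_mat_def)

lemma adjacency_mat_symmetric: "transpose_mat (adjacency_mat vs E) = adjacency_mat vs E"
  by (rule eq_matI) (auto simp: adjacency_mat_def insert_commute)

lemma char_poly_adjacency_mat_reorder:
  assumes "distinct vs" "distinct ws" "set vs = set ws"
  shows "char_poly (adjacency_mat vs E) = char_poly (adjacency_mat ws E)"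
proof -
  define n where "n = length vs"
  have lw: "length ws = n"
    using assms distinct_card n_def by metis
  define P :: "'a list \<Rightarrow> 'a list \<Rightarrow> real mat" where
    "P = (\<lambda>vs ws. mat n n (\<lambda>(i, j). if vs ! i = ws ! j then 1 else 0))"
  have ex: "\<exists>k<n. xs ! i = ys ! k"
    if "i < n" "length xs = n" "length ys = n" "set xs = set ys" for i and xs ys :: "'a list"
    using that by (metis in_set_conv_nth)
  have sum_left: "(\<Sum>k = 0..<n. (if xs ! i = ys ! k then 1 else 0) * f (ys ! k)) = (f (xs ! i) :: real)"
    if "i < n" "length xs = n" "length ys = n" "set xs = set ys" "distinct ys"
    for i and xs ys :: "'a list" and f
  proof -
    from ex[of i xs ys] that have "\<exists>k<n. xs ! i = ys ! k" by blast
    then obtain k where k: "k < n" "xs ! i = ys ! k" by blast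
    have "(\<Sum>l = 0..<n. (if xs ! i = ys ! l then 1 else 0) * f (ys ! l))
        = (\<Sum>l = 0..<n. if l = k then f (ys ! k) else 0)"
      using k that by (intro sum.cong) (auto simp: nth_eq_iff_index_eq)
    also have "\<dots> = f (xs ! i)" using k by simp
    finally show ?thesis .
  qed
  have inv: "P xs ys * P ys xs = 1\<^sub>m n"
    if "length xs = n" "length ys = n" "set xs = set ys" "distinct xs" "distinct ys" for xs ys
  proof (rule eq_matI)
    fix i j assume ij: "i < dim_row (1\<^sub>m n :: real mat)" "j < dim_col (1\<^sub>m n :: real mat)"
    then have "(P xs ys * P ys xs) $$ (i, j)
       = (\<Sum>k = 0..<n. (if xs ! i = ys ! k then 1 else 0) * (if ys ! k = xs ! j then 1 else 0))"
      by (auto simp: P_def scalar_prod_def intro!: sum.cong)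
    also have "\<dots> = (if xs ! i = xs ! j then 1 else 0)"
      by (rule sum_left) (use that ij in simp_all)
    finally show "(P xs ys * P ys xs) $$ (i, j) = 1\<^sub>m n $$ (i, j)"
      using that ij by (auto simp: nth_eq_iff_index_eq)
  qed (auto simp: P_def)
  have "adjacency_mat vs E * P vs ws = P vs ws * adjacency_mat ws E"
  proof (rule eq_matI)
    fix i j
    assume "i < dim_row (P vs ws * adjacency_mat ws E)" "j < dim_col (P vs ws * adjacency_mat ws E)"
    then have ij: "i < n" "j < n" by (auto simp: P_def adjacency_mat_def lw)
    have "(P vs ws * adjacency_mat ws E) $$ (i, j)
       = (\<Sum>k = 0..<n. P vs ws $$ (i, k) * adjacency_mat ws E $$ (k, j))"
      using ij lw by (simp add: P_def adjacency_mat_def scalar_prod_def)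
    also have "\<dots> = (\<Sum>k = 0..<n. (if vs ! i = ws ! k then 1 else 0) * (if {ws ! k, ws ! j} \<in> E then 1 else 0))"
      by (rule sum.cong[OF refl]) (use ij lw in \<open>simp add: P_def adjacency_mat_def\<close>)
    also have "\<dots> = (if {vs ! i, ws ! j} \<in> E then 1 else 0)"
      by (rule sum_left[of i vs ws "\<lambda>x. if {x, ws ! j} \<in> E then 1 else 0", OF ij(1) n_def[symmetric] lw assms(3,2)])
    finally have 1: "(P vs ws * adjacency_mat ws E) $$ (i, j) = (if {vs ! i, ws ! j} \<in> E then 1 else 0)" .
    have "(adjacency_mat vs E * P vs ws) $$ (i, j)
       = (\<Sum>k = 0..<n. adjacency_mat vs E $$ (i, k) * P vs ws $$ (k, j))"
      using ij by (simp add: P_def adjacency_mat_def scalar_prod_def n_def[symmetric])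
    also have "\<dots> = (\<Sum>k = 0..<n. (if ws ! j = vs ! k then 1 else 0) * (if {vs ! i, vs ! k} \<in> E then 1 else 0))"
      by (rule sum.cong[OF refl]) (use ij in \<open>auto simp: P_def adjacency_mat_def n_def[symmetric]\<close>)
    also have "\<dots> = (if {vs ! i, ws ! j} \<in> E then 1 else 0)"
      by (rule sum_left[of j ws vs "\<lambda>x. if {vs ! i, x} \<in> E then 1 else 0", OF ij(2) lw n_def[symmetric] assms(3)[symmetric] assms(1)])
    finally show "(adjacency_mat vs E * P vs ws) $$ (i, j) = (P vs ws * adjacency_mat ws E) $$ (i, j)"
      using 1 by simp
  qed (auto simp: P_def adjacency_mat_def lw n_def)
  note comm = this
  have car: "adjacency_mat vs E \<in> carrier_mat n n" "adjacency_mat ws E \<in> carrier_mat n n"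
    "P vs ws \<in> carrier_mat n n" "P ws vs \<in> carrier_mat n n"
    by (auto simp: P_def adjacency_mat_def lw n_def)
  have invs: "P vs ws * P ws vs = 1\<^sub>m n" "P ws vs * P vs ws = 1\<^sub>m n"
    using inv assms lw n_def by simp_all
  have "P vs ws * adjacency_mat ws E * P ws vs = adjacency_mat vs E * (P vs ws * P ws vs)"
    using car by (simp add: comm[symmetric])
  then have "adjacency_mat vs E = P vs ws * adjacency_mat ws E * P ws vs"
    using car invs by simp
  then have "similar_mat (adjacency_mat vs E) (adjacency_mat ws E)"
    using car invs by (intro similar_matI[of _ _ "P vs ws" "P ws vs" n]) auto
  then show ?thesis by (rule char_poly_similar)
qed

lemma graph_eigenvalue_eq:
  assumes "distinct vs" "set vs = V"
  shows "graph_eigenvalue V E k = eigenvalue_list (adjacency_mat vs E) ! (k - 1)"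
proof -
  have "finite V" using assms by auto
  then show ?thesis
    using char_poly_adjacency_mat_reorder[of vs "vertex_list V" E] assms vertex_list[of V]
    by (simp add: graph_eigenvalue_def eigenvalue_list_def)
qed

lemma real_eigenvalue_of_symmetric:
  assumes A: "A \<in> carrier_mat n n" and sym: "transpose_mat A = A"
    and ev: "eigenvalue (map_mat complex_of_real A) c"
  shows "c \<in> \<real>"
proof -
  obtain v where "eigenvector (map_mat complex_of_real A) v c"
    using ev unfolding eigenvalue_def by blast
  then have v: "dim_vec v = n" "v \<noteq> 0\<^sub>v n"
    and Av: "map_mat complex_of_real A *\<^sub>v v = c \<cdot>\<^sub>v v"
    using A unfolding eigenvector_def by simp_all
  have sym': "A $$ (i, j) = A $$ (j, i)" if "i < n" "j < n" for i j
    using that A arg_cong[OF sym, of "\<lambda>M. M $$ (i, j)"] by simp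
  define N where "N = (\<Sum>i<n. (cmod (v $ i))\<^sup>2)"
  define Q where "Q = (\<Sum>i<n. \<Sum>j<n. complex_of_real (A $$ (i, j)) * v $ j * cnj (v $ i))"
  have row: "(\<Sum>j<n. complex_of_real (A $$ (i, j)) * v $ j) = c * v $ i" if "i < n" for i
    using that A v arg_cong[OF Av, of "\<lambda>w. w $ i"]
    by (simp add: scalar_prod_def atLeast0LessThan)
  have "Q = (\<Sum>i<n. c * v $ i * cnj (v $ i))"
    unfolding Q_def by (intro sum.cong refl) (simp add: row sum_distrib_right[symmetric])
  also have "\<dots> = c * complex_of_real N"
    by (simp add: N_def sum_distrib_left mult.assoc complex_norm_square of_real_sum del: of_real_power)
  finally have Q: "Q = c * complex_of_real N" .
  have "cnj Q = (\<Sum>i<n. \<Sum>j<n. complex_of_real (A $$ (i, j)) * cnj (v $ j) * v $ i)"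
    by (simp add: Q_def)
  also have "\<dots> = (\<Sum>j<n. \<Sum>i<n. complex_of_real (A $$ (i, j)) * cnj (v $ j) * v $ i)"
    by (rule sum.swap)
  also have "\<dots> = Q"
    unfolding Q_def by (intro sum.cong refl) (auto simp: sym' mult_ac)
  finally have eq: "cnj c * complex_of_real N = c * complex_of_real N" using Q by simp
  obtain i where i: "i < n" "v $ i \<noteq> 0"
    using v by (metis eq_vecI index_zero_vec)
  have "0 < (cmod (v $ i))\<^sup>2" using i by simp
  also have "\<dots> \<le> N" unfolding N_def using i by (intro member_le_sum) auto
  finally have "N \<noteq> 0" by simp
  then show ?thesis using eq by (simp add: Reals_cnj_iff)
qed

lemma length_eigenvalue_list:
  assumes A: "A \<in> carrier_mat n n" and sym: "transpose_mat A = A"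
  shows "length (eigenvalue_list A) = n"
proof -
  let ?C = "map_mat complex_of_real A"
  have C: "?C \<in> carrier_mat n n" using A by simp
  from char_poly_factorized[OF C] obtain as
    where as: "char_poly ?C = (\<Prod>a\<leftarrow>as. [:- a, 1:])" "length as = n" by blast
  have "a \<in> \<real>" if "a \<in> set as" for a
  proof -
    have "poly (char_poly ?C) a = 0"
      using that by (auto simp: as poly_prod_list prod_list_zero_iff)
    then show ?thesis
      using real_eigenvalue_of_symmetric[OF A sym] eigenvalue_root_char_poly[OF C] by blast
  qed
  then have map: "map (\<lambda>a. complex_of_real (Re a)) as = as"
    by (intro map_idI) (simp add: of_real_Re)
  define bs where "bs = map Re as"
  have as_bs: "as = map complex_of_real bs" using map by (simp add: bs_def comp_def)
  interpret h: map_poly_inj_idom_hom complex_of_real ..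
  have "map_poly complex_of_real (char_poly A) = char_poly ?C"
    using of_real_hom.char_poly_hom[OF A] by metis
  also have "\<dots> = map_poly complex_of_real (\<Prod>b\<leftarrow>bs. [:- b, 1:])"
    by (simp add: as as_bs h.hom_prod_list comp_def)
  finally have "char_poly A = (\<Prod>b\<leftarrow>bs. [:- b, 1:])" by simp
  moreover have "proots (\<Prod>b\<leftarrow>bs. [:- b, 1:]) = mset bs"
  proof (induction bs)
    case (Cons b bs)
    have "(\<Prod>b\<leftarrow>bs. [:- b, 1:]) \<noteq> 0" by (auto simp: prod_list_zero_iff)
    then have "proots ([:- b, 1:] * (\<Prod>b\<leftarrow>bs. [:- b, 1:])) = {#b#} + mset bs"
      by (subst proots_mult) (use Cons in auto)
    then show ?case by (simp del: mult_pCons_left)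
  qed simp
  ultimately have "proots (char_poly A) = mset bs" by simp
  then have "length (eigenvalue_list A) = size (mset bs)"
    by (metis eigenvalue_list_def length_rev mset_sorted_list_of_multiset size_mset)
  then show ?thesis
    by (simp add: bs_def as)
qed

end

(* The adjacency matrices of G and of its complement add up to J - I, whose quadratic form
   (sum x)^2 - |x|^2 is at least -|x|^2. By a dimension count there is a nonzero x orthogonal to the
   first k - 1 eigenvectors of G and the first n - k eigenvectors of the complement; on it the two
   quadratic forms are at most mu_k(G) |x|^2 and mu_{n-k+1}(complement) |x|^2. So (this is Weyl's
   inequality) the sum of the two eigenvalues is already at least -1. *)

theory Submission
  imports Defs
begin

section \<open>Splitting of the characteristic polynomial over the reals\<close>

text \<open>Splitting off one linear factor lowers the degree by one and removes exactly one element
  from the multiset of roots, so the equality of the two counts passes to the quotient and induction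
  on the degree applies.\<close>

lemma splits_if_size_proots_eq_degree:
  fixes p :: "'a :: field poly"
  assumes "p \<noteq> 0" and "size (proots p) = degree p"
  shows "p = Polynomial.smult (lead_coeff p) (\<Prod>x\<in>#proots p. [:- x, 1:])"
  using assms
proof (induction "degree p" arbitrary: p)
  case 0
  then obtain c where "p = [:c:]" by (metis degree_eq_zeroE)
  then show ?case by simp
next
  case (Suc m)
  then obtain a where "a \<in># proots p" by (metis multiset_nonemptyE size_empty nat.distinct(1))
  then have "poly p a = 0" using Suc.prems by simp
  then obtain q where p: "p = [:- a, 1:] * q" by (auto simp: poly_eq_0_iff_dvd elim: dvdE)
  have q: "q \<noteq> 0" using p Suc.prems by auto
  have roots: "proots p = add_mset a (proots q)"
    unfolding p by (subst proots_mult) (use q in \<open>auto simp del: mult_pCons_left\<close>)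
  have deg: "degree p = Suc (degree q)"
    unfolding p by (subst degree_mult_eq) (use q in auto)
  define r where "r = (\<Prod>x\<in>#proots q. [:- x, 1:])"
  have "q = Polynomial.smult (lead_coeff q) r"
    unfolding r_def by (rule Suc.hyps(1)) (use Suc.hyps(2) Suc.prems roots deg q in auto)
  then have "[:- a, 1:] * q = Polynomial.smult (lead_coeff q) ([:- a, 1:] * r)"
    by (metis mult_smult_right)
  moreover have "lead_coeff p = lead_coeff q" unfolding p by (subst lead_coeff_mult) simp
  ultimately have "p = Polynomial.smult (lead_coeff p) ([:- a, 1:] * r)" using p by metis
  then show ?case by (simp only: roots image_mset_add_mset prod_mset.add_mset r_def)
qed

text \<open>Symmetry enters through \<open>length_eigenvalue_list\<close>: there are as many real
  roots as the degree. The product keeps the order of the list, and the diagonalization below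
  inherits this order.\<close>

lemma char_poly_eq_prod_eigenvalue_list:
  assumes A: "A \<in> carrier_mat n n" and sym: "transpose_mat A = A"
  shows "char_poly A = (\<Prod>e\<leftarrow>eigenvalue_list A. [:- e, 1:])"
proof -
  have monic: "degree (char_poly A) = n" "lead_coeff (char_poly A) = 1"
    using degree_monic_char_poly[OF A] by auto
  have mset: "mset (eigenvalue_list A) = proots (char_poly A)"
    by (simp add: eigenvalue_list_def)
  then have "size (proots (char_poly A)) = n"
    using length_eigenvalue_list[OF A sym] by (metis size_mset)
  then have "char_poly A = (\<Prod>e\<in>#proots (char_poly A). [:- e, 1:])"
    using splits_if_size_proots_eq_degree[of "char_poly A"] monic by fastforce
  also have "\<dots> = (\<Prod>e\<leftarrow>eigenvalue_list A. [:- e, 1:])"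
    unfolding mset[symmetric] mset_map[symmetric] prod_mset_prod_list ..
  finally show ?thesis .
qed

lemma eigenvalue_list_antimono:
  assumes "i \<le> j" "j < length (eigenvalue_list A)"
  shows "eigenvalue_list A ! j \<le> eigenvalue_list A ! i"
  using assms unfolding eigenvalue_list_def
  by (intro sorted_rev_nth_mono) (simp_all add: sorted_sorted_list_of_multiset)

section \<open>Householder reflections\<close>

text \<open>The Householder reflection exchanging \<open>v\<close> with the first unit vector; for \<open>v\<close> equal to the
  first unit vector the quotient is \<open>0 / 0 = 0\<close> and the matrix is the identity, as it should be.\<close>

definition householder :: "real vec \<Rightarrow> real mat" where
  "householder v =
     (let n = dim_vec v; u = v - unit_vec n 0
      in mat n n (\<lambda>(i, j). (if i = j then 1 else 0) - u $ i * u $ j / (1 - v $ 0)))"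

lemma householder_carrier: "v \<in> carrier_vec n \<Longrightarrow> householder v \<in> carrier_mat n n"
  by (auto simp: householder_def Let_def)

lemma transpose_householder: "transpose_mat (householder v) = householder v"
  by (rule eq_matI) (auto simp: householder_def Let_def)

text \<open>For a unit vector \<open>v\<close> and \<open>u = v - unit_vec n 0\<close> one has
  \<open>u \<bullet> u = 2 * (1 - v $ 0)\<close>. The matrix therefore subtracts twice the
  projection onto \<open>u\<close> and is the usual reflection.\<close>

lemma householder_props:
  assumes v: "v \<in> carrier_vec n" and n: "0 < n" and unit: "v \<bullet> v = 1"
  shows "householder v * householder v = 1\<^sub>m n"
    and "householder v *\<^sub>v unit_vec n 0 = v"
proof -
  define u where "u = v - unit_vec n 0"
  define c where "c = 1 - v $ 0"
  have u: "u $ i = v $ i - (if i = 0 then 1 else 0)" if "i < n" for i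
    using that v by (simp add: u_def)
  have dim: "dim_vec v = n" using v by simp
  have H: "householder v = mat n n (\<lambda>(i, j). (if i = j then 1 else 0) - u $ i * u $ j / c)"
    using v by (simp add: householder_def Let_def u_def c_def)
  have vv: "(\<Sum>k = 0..<n. v $ k * v $ k) = 1"
    using unit v by (simp add: scalar_prod_def)
  have uu: "(\<Sum>k = 0..<n. u $ k * u $ k) = 2 * c"
  proof -
    have "(\<Sum>k = 0..<n. u $ k * u $ k)
        = (\<Sum>k = 0..<n. v $ k * v $ k + (if k = 0 then 1 - 2 * v $ 0 else 0))"
      by (intro sum.cong) (auto simp: u algebra_simps)
    also have "\<dots> = 2 * c" using n by (simp add: sum.distrib vv c_def)
    finally show ?thesis .
  qed
  \<comment> \<open>This covers the division by zero: if \<open>c = 0\<close>, the squares of the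
    entries of \<open>u\<close> sum to 0.\<close>
  have u0: "u $ i = 0" if "c = 0" "i < n" for i
  proof -
    have "u $ i * u $ i \<le> (\<Sum>k = 0..<n. u $ k * u $ k)"
      using that by (intro member_le_sum) auto
    then show ?thesis using uu that by (auto simp: mult_le_0_iff)
  qed
  show "householder v * householder v = 1\<^sub>m n"
  proof (rule eq_matI)
    fix i j assume "i < dim_row (1\<^sub>m n :: real mat)" "j < dim_col (1\<^sub>m n :: real mat)"
    then have ij: "i < n" "j < n" by auto
    have "(householder v * householder v) $$ (i, j)
       = (\<Sum>k = 0..<n. ((if i = k then 1 else 0) - u $ i * u $ k / c)
            * ((if k = j then 1 else 0) - u $ k * u $ j / c))"
      using ij by (simp add: H scalar_prod_def)
    also have "\<dots> = (\<Sum>k = 0..<n. (if k = i then (if i = j then 1 else 0) - u $ i * u $ j / c else 0)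
        - (if k = j then u $ i * u $ j / c else 0)
        + u $ i * u $ j / c / c * (u $ k * u $ k))"
      by (intro sum.cong refl) (auto simp: algebra_simps)
    also have "\<dots> = (if i = j then 1 else 0) - 2 * (u $ i * u $ j / c)
        + u $ i * u $ j / c / c * (2 * c)"
      unfolding sum.distrib sum_subtractf sum_distrib_left[symmetric] uu using ij by simp
    also have "\<dots> = (1\<^sub>m n) $$ (i, j)"
      using ij by (cases "c = 0") auto
    finally show "(householder v * householder v) $$ (i, j) = (1\<^sub>m n) $$ (i, j)" .
  qed (auto simp: H)
  show "householder v *\<^sub>v unit_vec n 0 = v"
  proof (rule eq_vecI)
    fix i assume "i < dim_vec v"
    then have i: "i < n" using v by simp
    have "(householder v *\<^sub>v unit_vec n 0) $ i = (if i = 0 then 1 else 0) - u $ i * u $ 0 / c"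
      using i n by (simp add: H scalar_prod_right_unit[of 0 n])
    \<comment> \<open>Since \<open>u $ 0 = - c\<close>, the quotient is \<open>- u $ i\<close>; for
      \<open>c = 0\<close> both are 0.\<close>
    also have "\<dots> = (if i = 0 then 1 else 0) + u $ i"
      using n i u0 by (cases "c = 0") (auto simp: u[of 0] c_def field_simps)
    also have "\<dots> = v $ i" using i by (simp add: u)
    finally show "(householder v *\<^sub>v unit_vec n 0) $ i = v $ i" .
  qed (simp add: H dim)
qed

section \<open>Orthogonal diagonalization of real symmetric matrices\<close>

lemma scalar_prod_self_pos:
  fixes w :: "real vec"
  assumes w: "w \<in> carrier_vec n" "w \<noteq> 0\<^sub>v n"
  shows "0 < w \<bullet> w"
proof -
  obtain i where i: "i < n" "w $ i \<noteq> 0"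
    using w by (metis carrier_vecD eq_vecI index_zero_vec)
  then have "0 < w $ i * w $ i" by (auto simp: zero_less_mult_iff)
  also have "\<dots> \<le> w \<bullet> w"
    unfolding scalar_prod_def using i w by (intro member_le_sum) auto
  finally show ?thesis .
qed

lemma unit_eigenvector_exists:
  fixes A :: "real mat"
  assumes A: "A \<in> carrier_mat n n" and e: "eigenvalue A e"
  obtains v where "v \<in> carrier_vec n" "v \<bullet> v = 1" "A *\<^sub>v v = e \<cdot>\<^sub>v v"
proof -
  obtain w where w: "w \<in> carrier_vec n" "w \<noteq> 0\<^sub>v n" "A *\<^sub>v w = e \<cdot>\<^sub>v w"
    using e A unfolding eigenvalue_def eigenvector_def by auto
  have pos: "w \<bullet> w > 0" by (rule scalar_prod_self_pos[OF w(1,2)])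
  define s where "s = 1 / sqrt (w \<bullet> w)"
  show ?thesis
  proof (rule that[of "s \<cdot>\<^sub>v w"])
    show "s \<cdot>\<^sub>v w \<in> carrier_vec n" using w by simp
    have "(s \<cdot>\<^sub>v w) \<bullet> (s \<cdot>\<^sub>v w) = s * s * (w \<bullet> w)" using w by simp
    also have "\<dots> = 1" using pos by (simp add: s_def)
    finally show "(s \<cdot>\<^sub>v w) \<bullet> (s \<cdot>\<^sub>v w) = 1" .
    show "A *\<^sub>v (s \<cdot>\<^sub>v w) = e \<cdot>\<^sub>v (s \<cdot>\<^sub>v w)"
      using w A by (simp add: mult_mat_vec smult_smult_assoc mult.commute)
  qed
qed

text \<open>The spectral theorem by deflation: a reflection moves a unit eigenvector for the first
  root to the first unit vector, and the remaining block is again symmetric. Having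
  \<open>transpose_mat P\<close> as the inverse makes \<open>P\<close> orthogonal, and the diagonal
  follows the given order of the roots.\<close>

lemma symmetric_mat_diagonalization:
  fixes A :: "real mat"
  assumes "A \<in> carrier_mat n n" and "transpose_mat A = A"
    and "char_poly A = (\<Prod>e\<leftarrow>es. [:- e, 1:])"
  shows "\<exists>P. similar_mat_wit A (mat_diag n ((!) es)) P (transpose_mat P)"
  using assms
proof (induction es arbitrary: n A)
  case Nil
  then have "n = 0" using degree_monic_char_poly[of A n] by simp
  then have "similar_mat_wit A (mat_diag n ((!) [])) (1\<^sub>m n) (transpose_mat (1\<^sub>m n))"
    using Nil by (intro similar_mat_witI[of _ _ n]) (auto intro!: eq_matI)
  then show ?case by blast
next
  case (Cons e es)
  note A = Cons.prems(1) and sym = Cons.prems(2)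
  have "degree (char_poly A) = Suc (degree (\<Prod>e\<leftarrow>es. [:- e, 1:]))"
    unfolding Cons.prems(3) list.map prod_list.Cons
    by (subst degree_mult_eq) (auto simp: prod_list_zero_iff)
  then obtain m where n: "n = Suc m" using degree_monic_char_poly[OF A] by (metis)
  have "eigenvalue A e" unfolding eigenvalue_root_char_poly[OF A] Cons.prems(3) by simp
  from unit_eigenvector_exists[OF A this] obtain v
    where v: "v \<in> carrier_vec n" "v \<bullet> v = 1" "A *\<^sub>v v = e \<cdot>\<^sub>v v" by blast
  define H where "H = householder v"
  have H: "H \<in> carrier_mat n n" "transpose_mat H = H" "H * H = 1\<^sub>m n" "H *\<^sub>v unit_vec n 0 = v"
    using householder_carrier transpose_householder householder_props[of v n] v n
    by (auto simp: H_def)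
  define B where "B = H * A * H"
  have B: "B \<in> carrier_mat n n" using A H by (simp add: B_def)
  have symB: "transpose_mat B = B"
    using A H sym by (simp add: B_def transpose_mult[of _ n n _ n] assoc_mult_mat[of _ n n _ n _ n])
  have simAB: "similar_mat_wit A B H H"
  proof (rule similar_mat_witI[of _ _ n])
    have "H * B * H = (H * H) * A * (H * H)"
      unfolding B_def using A H(1) by (simp add: assoc_mult_mat[of _ n n _ n _ n])
    then show "A = H * B * H" using A H by simp
  qed (use A B H in auto)
  have Hv: "H *\<^sub>v v = unit_vec n 0"
  proof -
    have "H *\<^sub>v v = (H * H) *\<^sub>v unit_vec n 0"
      using H(1) H(4) by (simp add: assoc_mult_mat_vec[of _ n n _ n])
    then show ?thesis using H by simp
  qed
  have col0: "B *\<^sub>v unit_vec n 0 = e \<cdot>\<^sub>v unit_vec n 0"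
  proof -
    have "B *\<^sub>v unit_vec n 0 = H *\<^sub>v (A *\<^sub>v v)"
      unfolding B_def using A H(1) H(4) by (simp add: assoc_mult_mat_vec[of _ n n _ n])
    also have "\<dots> = e \<cdot>\<^sub>v unit_vec n 0" using v H(1) Hv by (simp add: mult_mat_vec)
    finally show ?thesis .
  qed
  have B0: "B $$ (i, 0) = (if i = 0 then e else 0)" if "i < n" for i
    using arg_cong[OF col0, of "\<lambda>w. w $ i"] that n B by (simp add: scalar_prod_right_unit[of 0 n])
  have sym_at: "B $$ (i, j) = B $$ (j, i)" if "i < n" "j < n" for i j
    using that B arg_cong[OF symB, of "\<lambda>M. M $$ (i, j)"] by simp
  define C where "C = mat m m (\<lambda>(i, j). B $$ (Suc i, Suc j))"
  have C: "C \<in> carrier_mat m m" "transpose_mat C = C"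
    by (auto simp: C_def n intro!: eq_matI sym_at)
  define E where "E = mat 1 1 (\<lambda>_. e)"
  have E: "E \<in> carrier_mat 1 1" by (simp add: E_def)
  \<comment> \<open>The first column of \<open>B\<close> is known from \<open>B0\<close>; symmetry
    gives the first row.\<close>
  have block: "B = four_block_mat E (0\<^sub>m 1 m) (0\<^sub>m m 1) C"
  proof (rule eq_matI)
    fix i j
    assume "i < dim_row (four_block_mat E (0\<^sub>m 1 m) (0\<^sub>m m 1) C)"
      "j < dim_col (four_block_mat E (0\<^sub>m 1 m) (0\<^sub>m m 1) C)"
    then have ij: "i < Suc m" "j < Suc m" using C E by auto
    show "B $$ (i, j) = four_block_mat E (0\<^sub>m 1 m) (0\<^sub>m m 1) C $$ (i, j)"
      using ij B0[of i] B0[of j] sym_at[of 0 j] C(1) n by (auto simp: E_def C_def)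
  qed (use B C E n in auto)
  have "char_poly A = char_poly B"
    using simAB by (intro char_poly_similar) (auto simp: similar_mat_def)
  also have "\<dots> = char_poly E * char_poly C"
    unfolding block by (rule char_poly_four_block_zeros_col) (use C E in auto)
  also have "char_poly E = [:- e, 1:]"
    by (simp add: E_def char_poly_defs det_def sign_def)
  \<comment> \<open>The common factor \<open>[:- e, 1:]\<close> cancels, which leaves the tail of
    the list for the induction hypothesis.\<close>
  finally have "char_poly C = (\<Prod>e\<leftarrow>es. [:- e, 1:])"
    using Cons.prems(3) by (simp del: mult_pCons_left)
  from Cons.IH[OF C this] obtain P
    where P: "similar_mat_wit C (mat_diag m ((!) es)) P (transpose_mat P)" by blast
  have Pc: "P \<in> carrier_mat m m" using similar_mat_witD2[OF C(1) P] by simp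
  define Q where "Q = four_block_mat (1\<^sub>m 1) (0\<^sub>m 1 m) (0\<^sub>m m 1) P"
  have Qt: "transpose_mat Q = four_block_mat (1\<^sub>m 1) (0\<^sub>m 1 m) (0\<^sub>m m 1) (transpose_mat P)"
    unfolding Q_def by (subst transpose_four_block_mat[of _ 1 1 _ m _ m]) (use Pc in auto)
  have "mat_diag n ((!) (e # es)) = four_block_mat E (0\<^sub>m 1 m) (0\<^sub>m m 1) (mat_diag m ((!) es))"
    by (rule eq_matI) (auto simp: mat_diag_def E_def n nth_Cons')
  then have "similar_mat_wit B (mat_diag n ((!) (e # es))) Q (transpose_mat Q)"
    unfolding Qt unfolding block Q_def
    using similar_mat_wit_four_block[OF similar_mat_wit_refl[OF E] P _ _ E C(1),
        of "0\<^sub>m 1 m" "0\<^sub>m 1 m" "0\<^sub>m m 1" "0\<^sub>m m 1"] Pc by simp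
  from similar_mat_wit_trans[OF simAB this]
  have "similar_mat_wit A (mat_diag n ((!) (e # es))) (H * Q) (transpose_mat Q * H)" .
  moreover have "transpose_mat (H * Q) = transpose_mat Q * H"
    using H Pc n by (subst transpose_mult[of _ n n _ n]) (auto simp: Q_def)
  ultimately show ?case by metis
qed

section \<open>Weyl's inequality by a dimension count\<close>

text \<open>In the coordinates \<open>y = transpose_mat P *\<^sub>v x\<close> the form is the sum of
  \<open>d i * (y $ i)\<^sup>2\<close>, and \<open>y\<close> has the same norm as \<open>x\<close>
  because \<open>P\<close> is orthogonal. The assumption \<open>zero\<close> says that
  \<open>x\<close> is orthogonal to the first \<open>m\<close> columns of \<open>P\<close>, so only
  the entries bounded by \<open>c\<close> contribute.\<close>

lemma quadratic_form_le:
  fixes A :: "real mat"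
  assumes A: "A \<in> carrier_mat n n"
    and sim: "similar_mat_wit A (mat_diag n d) P (transpose_mat P)"
    and x: "x \<in> carrier_vec n"
    and zero: "\<And>i. i < m \<Longrightarrow> (transpose_mat P *\<^sub>v x) $ i = 0"
    and le: "\<And>i. m \<le> i \<Longrightarrow> i < n \<Longrightarrow> d i \<le> c"
  shows "x \<bullet> (A *\<^sub>v x) \<le> c * (x \<bullet> x)"
proof -
  define y where "y = transpose_mat P *\<^sub>v x"
  have P: "P \<in> carrier_mat n n" "P * transpose_mat P = 1\<^sub>m n" "A = P * mat_diag n d * transpose_mat P"
    using similar_mat_witD2[OF A sim] by blast+
  have y: "y \<in> carrier_vec n" using P x by (simp add: y_def)
  have Py: "P *\<^sub>v y = x"
    unfolding y_def using P(1) x by (simp add: assoc_mult_mat_vec[of _ n n _ n, symmetric] P(2))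
  have Ax: "A *\<^sub>v x = P *\<^sub>v (mat_diag n d *\<^sub>v y)"
    unfolding P(3) y_def using P(1) x mat_diag_dim[of n d]
    by (simp add: assoc_mult_mat_vec[of _ n n _ n])
  have Dy: "(mat_diag n d *\<^sub>v y) $ i = d i * y $ i" if "i < n" for i
  proof -
    have "(mat_diag n d *\<^sub>v y) $ i = (\<Sum>j = 0..<n. (if i = j then d j else 0) * y $ j)"
      using that y by (simp add: mat_diag_def scalar_prod_def)
    also have "\<dots> = (\<Sum>j = 0..<n. if j = i then d i * y $ i else 0)"
      by (intro sum.cong) auto
    finally show ?thesis using that by simp
  qed
  have "x \<bullet> (A *\<^sub>v x) = y \<bullet> (mat_diag n d *\<^sub>v y)"
    unfolding Ax y_def
    by (rule transpose_vec_mult_scalar[symmetric, of _ n n]) (use P x mat_diag_dim[of n d] in \<open>auto intro!: mult_mat_vec_carrier[of _ n n]\<close>)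
  also have "\<dots> = (\<Sum>i = 0..<n. d i * (y $ i * y $ i))"
    unfolding scalar_prod_def
    by (rule sum.cong, simp add: mat_diag_def) (simp add: Dy del: index_mult_mat_vec)
  also have "\<dots> \<le> (\<Sum>i = 0..<n. c * (y $ i * y $ i))"
  proof (rule sum_mono)
    fix i assume "i \<in> {0..<n}"
    then show "d i * (y $ i * y $ i) \<le> c * (y $ i * y $ i)"
      using zero[of i] le[of i] by (cases "i < m") (auto simp: y_def[symmetric] intro!: mult_right_mono)
  qed
  also have "\<dots> = c * (y \<bullet> y)" using y by (simp add: scalar_prod_def sum_distrib_left)
  also have "y \<bullet> y = x \<bullet> (P *\<^sub>v y)"
    by (subst (1) y_def, rule transpose_vec_mult_scalar[of _ n n]) (use P x y in auto)
  finally show ?thesis unfolding Py .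
qed

text \<open>The two families impose (k - 1) + (n - k) = n - 1 linear conditions on a vector of
  dimension n, so some nonzero \<open>x\<close> meets them all. Comparing the bounds on both forms
  at this \<open>x\<close> and dividing by \<open>x \<bullet> x\<close> gives the claim.\<close>

lemma eigenvalue_list_add_ge:
  assumes A: "A \<in> carrier_mat n n" "transpose_mat A = A"
    and B: "B \<in> carrier_mat n n" "transpose_mat B = B"
    and k: "1 \<le> k" "k \<le> n"
    and ge: "\<And>x. x \<in> carrier_vec n \<Longrightarrow> c * (x \<bullet> x) \<le> x \<bullet> (A *\<^sub>v x) + x \<bullet> (B *\<^sub>v x)"
  shows "c \<le> eigenvalue_list A ! (k - 1) + eigenvalue_list B ! (n - k)"
proof -
  obtain P where P: "similar_mat_wit A (mat_diag n ((!) (eigenvalue_list A))) P (transpose_mat P)"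
    using symmetric_mat_diagonalization[OF A char_poly_eq_prod_eigenvalue_list[OF A]] by blast
  obtain R where R: "similar_mat_wit B (mat_diag n ((!) (eigenvalue_list B))) R (transpose_mat R)"
    using symmetric_mat_diagonalization[OF B char_poly_eq_prod_eigenvalue_list[OF B]] by blast
  have car: "P \<in> carrier_mat n n" "R \<in> carrier_mat n n"
    using similar_mat_witD2[OF A(1) P] similar_mat_witD2[OF B(1) R] by auto
  text \<open>The first \<open>k - 1\<close> eigenvectors of \<open>A\<close> and the first \<open>n - k\<close> of \<open>B\<close> leave one row of \<open>M\<close>
    zero, so that \<open>M\<close> is singular.\<close>
  define M where "M = mat n n (\<lambda>(i, j). if i < k - 1 then P $$ (j, i)
    else if i < n - 1 then R $$ (j, i - (k - 1)) else 0)"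
  have M: "M \<in> carrier_mat n n" by (simp add: M_def)
  \<comment> \<open>The zero row of \<open>M\<close> is the last one, so the transpose annihilates
    the last unit vector.\<close>
  have "transpose_mat M *\<^sub>v unit_vec n (n - 1) = 0\<^sub>v n"
    using k by (intro eq_vecI) (auto simp: M_def scalar_prod_right_unit[of "n - 1" n])
  then have "det (transpose_mat M) = 0"
    using M k by (subst det_0_iff_vec_prod_zero[of _ n]) (auto intro!: exI[of _ "unit_vec n (n - 1)"])
  then have "det M = 0" using det_transpose[OF M] by simp
  then obtain x where x: "x \<in> carrier_vec n" "x \<noteq> 0\<^sub>v n" "M *\<^sub>v x = 0\<^sub>v n"
    using det_0_iff_vec_prod_zero[OF M] by blast
  have Mx: "(\<Sum>j = 0..<n. M $$ (i, j) * x $ j) = 0" if "i < n" for i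
    using that M x(1) arg_cong[OF x(3), of "\<lambda>w. w $ i"] by (simp add: scalar_prod_def)
  have xA: "(transpose_mat P *\<^sub>v x) $ i = 0" if "i < k - 1" for i
    using that k car x(1) Mx[of i] by (simp add: M_def scalar_prod_def)
  have xB: "(transpose_mat R *\<^sub>v x) $ i = 0" if i: "i < n - k" for i
  proof -
    \<comment> \<open>Row \<open>i + (k - 1)\<close> of \<open>M\<close> holds column
      \<open>i\<close> of \<open>R\<close>; it lies before the zero row exactly because
      \<open>i < n - k\<close>.\<close>
    obtain l where l: "l < n" "\<not> l < k - 1" "l < n - 1" "l - (k - 1) = i" "i < n"
      using i k by (intro that[of "i + (k - 1)"]) auto
    then show ?thesis
      using car x(1) Mx[OF l(1)] by (simp add: M_def scalar_prod_def)
  qed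
  \<comment> \<open>As the list is decreasing, its entry at \<open>k - 1\<close> bounds all entries
    from that position on.\<close>
  have "x \<bullet> (A *\<^sub>v x) \<le> eigenvalue_list A ! (k - 1) * (x \<bullet> x)"
    by (rule quadratic_form_le[OF A(1) P x(1), of "k - 1"])
      (use xA in \<open>auto intro!: eigenvalue_list_antimono simp: length_eigenvalue_list[OF A]\<close>)
  moreover have "x \<bullet> (B *\<^sub>v x) \<le> eigenvalue_list B ! (n - k) * (x \<bullet> x)"
    by (rule quadratic_form_le[OF B(1) R x(1), of "n - k"])
      (use xB in \<open>auto intro!: eigenvalue_list_antimono simp: length_eigenvalue_list[OF B]\<close>)
  ultimately have "c * (x \<bullet> x)
      \<le> (eigenvalue_list A ! (k - 1) + eigenvalue_list B ! (n - k)) * (x \<bullet> x)"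
    using ge[OF x(1)] by (simp add: algebra_simps)
  moreover have "0 < x \<bullet> x" by (rule scalar_prod_self_pos[OF x(1,2)])
  ultimately show ?thesis by simp
qed

section \<open>A graph and its complement\<close>

text \<open>Two distinct vertices form an edge of exactly one of the two graphs, and a singleton is
  an edge of neither. The coefficients of the two forms thus add up to 1 off the diagonal and to 0
  on it.\<close>

lemma adjacency_complement_quadratic_form:
  assumes G: "simple_graph V E" and vs: "distinct vs" "set vs = V"
    and x: "x \<in> carrier_vec (length vs)"
  shows "x \<bullet> (adjacency_mat vs E *\<^sub>v x) + x \<bullet> (adjacency_mat vs (complement_edges V E) *\<^sub>v x)
    = (\<Sum>i = 0..<length vs. x $ i)\<^sup>2 - x \<bullet> x"
proof -
  define n where "n = length vs"
  have form: "x \<bullet> (adjacency_mat vs F *\<^sub>v x)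
      = (\<Sum>i = 0..<n. \<Sum>j = 0..<n. (if {vs ! i, vs ! j} \<in> F then x $ i * x $ j else 0))" for F
    using x unfolding scalar_prod_def n_def
    by (auto simp: adjacency_mat_def scalar_prod_def sum_distrib_left intro!: sum.cong)
  have entry: "(if {vs ! i, vs ! j} \<in> E then x $ i * x $ j else 0)
      + (if {vs ! i, vs ! j} \<in> complement_edges V E then x $ i * x $ j else 0)
      = x $ i * x $ j - (if j = i then x $ i * x $ i else 0)" if "i < n" "j < n" for i j
  proof -
    have "vs ! i \<in> V" "vs ! j \<in> V" "vs ! i = vs ! j \<longleftrightarrow> i = j"
      using that vs by (auto simp: n_def nth_eq_iff_index_eq)
    then have "card {vs ! i, vs ! j} = (if i = j then 1 else 2)" by auto
    then show ?thesis
      using G \<open>vs ! i \<in> V\<close> \<open>vs ! j \<in> V\<close>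
      by (auto simp: complement_edges_def simple_graph_def split: if_splits)
  qed
  have "x \<bullet> (adjacency_mat vs E *\<^sub>v x) + x \<bullet> (adjacency_mat vs (complement_edges V E) *\<^sub>v x)
      = (\<Sum>i = 0..<n. \<Sum>j = 0..<n. x $ i * x $ j - (if j = i then x $ i * x $ i else 0))"
    unfolding form sum.distrib[symmetric] by (intro sum.cong refl entry) auto
  also have "\<dots> = (\<Sum>i = 0..<n. x $ i)\<^sup>2 - x \<bullet> x"
    using x by (simp add: sum_subtractf power2_eq_square sum_product scalar_prod_def n_def)
  finally show ?thesis by (simp add: n_def)
qed

theorem theorem11:
  fixes V :: "'a set" and E :: "'a set set" and n k :: nat
  assumes "simple_graph V E" and "card V = n" and "k \<in> {1..n - 1}"
  shows "graph_eigenvalue V E k + graph_eigenvalue V (complement_edges V E) (n - k + 1)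
           \<ge> - 1 - 2 * sqrt (2 * degree_deviation V E)"
proof -
  define vs where "vs = vertex_list V"
  have "finite V" using assms(1) by (simp add: simple_graph_def)
  then have vs: "distinct vs" "set vs = V" "length vs = n"
    using vertex_list assms(2) by (auto simp: vs_def)
  have "- 1 \<le> eigenvalue_list (adjacency_mat vs E) ! (k - 1)
      + eigenvalue_list (adjacency_mat vs (complement_edges V E)) ! (n - k)"
  proof (rule eigenvalue_list_add_ge)
    fix x :: "real vec" assume "x \<in> carrier_vec n"
    then show "- 1 * (x \<bullet> x) \<le> x \<bullet> (adjacency_mat vs E *\<^sub>v x)
        + x \<bullet> (adjacency_mat vs (complement_edges V E) *\<^sub>v x)"
      \<comment> \<open>The square of the sum of the entries is nonnegative and is dropped.\<close>
      using adjacency_complement_quadratic_form[OF assms(1) vs(1,2)] vs(3) by simp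
  qed (use assms(3) adjacency_mat_carrier[of vs] adjacency_mat_symmetric[of vs] vs(3) in auto)
  \<comment> \<open>The deviation is a sum of absolute values, so the claimed bound is at most
    -1.\<close>
  moreover have "0 \<le> sqrt (2 * degree_deviation V E)"
    unfolding degree_deviation_def by (intro real_sqrt_ge_zero mult_nonneg_nonneg sum_nonneg) auto
  ultimately show ?thesis
    \<comment> \<open>Counting from 1, the index \<open>n - k + 1\<close> denotes the list position
      \<open>n - k\<close>.\<close>
    unfolding graph_eigenvalue_def vs_def add_diff_cancel_right' by linarith
qed

end
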